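(* Let $E$ be a field of characteristic two and let $A$ be an inverse-closed additive subgroup of $E$. Then there is a subfield $F$ of $E$ such that $A\subseteq F$ and $A$ is an $F^2$-subspace of $F$.
   Context: For a subset $S$ of a field $E$, write $S^{-1}=\{s^{-1}\mid 0\neq s\in S\}$. The subset $S$ is called inverse-closed if $S^{-1}\subseteq S$. For a field $F$ of characteristic two, $F^2=\{x^2\mid x\in F\}$ denotes the subfield of squares of elements of $F$, and $F$ is regarded as a vector space over $F^2$ via multiplication. *)

theory Defs
  imports "HOL-Algebra.Subrings" "Jordan_Normal_Form.Missing_VectorSpace"
begin

text \<open>The non-negative generator of the ideal of all integers \<open>n\<close> with \<open>n \<cdot> 1 = 0\<close>; this is
  the record-based analogue of \<^const>\<open>semiring_char\<close>.\<close>

definition ring_characteristic :: "('a, 'b) ring_scheme \<Rightarrow> nat" where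
  "ring_characteristic R = Gcd {n :: nat. [n] \<cdot>\<^bsub>R\<^esub> \<one>\<^bsub>R\<^esub> = \<zero>\<^bsub>R\<^esub>}"

definition set_inverses :: "('a, 'b) ring_scheme \<Rightarrow> 'a set \<Rightarrow> 'a set" where
  "set_inverses E S = {inv\<^bsub>E\<^esub> s | s. s \<in> S \<and> s \<noteq> \<zero>\<^bsub>E\<^esub>}"

definition inverse_closed :: "('a, 'b) ring_scheme \<Rightarrow> 'a set \<Rightarrow> bool" where
  "inverse_closed E S \<longleftrightarrow> set_inverses E S \<subseteq> S"

definition squares :: "('a, 'b) ring_scheme \<Rightarrow> 'a set \<Rightarrow> 'a set" where
  "squares E F = {x [^]\<^bsub>E\<^esub> (2::nat) | x. x \<in> F}"

text \<open>The additive group of \<open>F\<close> with scalar multiplication given by the multiplication of \<open>E\<close>.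
  The field of scalars is not part of a \<^type>\<open>module_ext\<close> record.\<close>

definition mult_module :: "('a, 'b) ring_scheme \<Rightarrow> 'a set \<Rightarrow> ('a, 'a) module" where
  "mult_module E F =
     \<lparr>carrier = F, mult = mult E, one = one E, zero = zero E, add = add E, smult = mult E\<rparr>"

end

theory Submission
  imports Defs "HOL-Algebra.Multiplicative_Group"
begin

text \<open>
  The subfield is \<open>F = {x \<in> E. x\<^sup>2 A \<subseteq> A}\<close>, the set of those elements whose squares act on \<open>A\<close>
  by multiplication. With this choice \<open>A\<close> is stable under \<open>F\<^sup>2\<close> by definition, and what remains
  is that \<open>F\<close> is a subfield containing \<open>A\<close>.

  Closure of \<open>F\<close> under products is clear, and closure under sums holds because squaring is additive
  in characteristic two. Both remaining points use that \<open>A\<close> is inverse-closed. If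
  \<open>0 \<noteq> x \<in> F\<close> and \<open>0 \<noteq> a \<in> A\<close>, then \<open>x\<^sup>2 a\<^sup>-\<^sup>1 \<in> A\<close>, and the inverse of this element is
  \<open>x\<^sup>-\<^sup>2 a\<close>; hence \<open>x\<^sup>-\<^sup>1 \<in> F\<close> (lemma \<open>square_stabilizer_inv\<close>). Finally, \<open>A \<subseteq> F\<close> means that
  \<open>a\<^sup>2 b \<in> A\<close> for \<open>a, b \<in> A\<close>, which is Hua's identity
  \<open>a + (a\<^sup>-\<^sup>1 + (b\<^sup>-\<^sup>1 + a)\<^sup>-\<^sup>1)\<^sup>-\<^sup>1 = a\<^sup>2 b\<close> (lemma \<open>inverse_closed_square_mult\<close>): its left-hand side
  is built from \<open>a\<close> and \<open>b\<close> by sums and inverses alone.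
\<close>

section \<open>Characteristic, inverses and extensions of subfields\<close>

text \<open>The integers \<open>n\<close> with \<open>n \<cdot> 1 = 0\<close> are the multiples of the additive order of \<open>1\<close>, so the
  greatest common divisor in the definition of the characteristic is itself one of them.\<close>

lemma (in ring) add_pow_ring_characteristic:
  "[ring_characteristic R] \<cdot> \<one> = \<zero>"
proof -
  have dvd: "[n] \<cdot> \<one> = \<zero> \<longleftrightarrow> add.ord \<one> dvd n" for n :: nat
    using add.pow_eq_id[of \<one> n] by (simp add: add_pow_def)
  have "ring_characteristic R = Gcd {n. add.ord \<one> dvd n}"
    unfolding ring_characteristic_def dvd ..
  also have "\<dots> = add.ord \<one>"
    by (intro gcd_nat.antisym Gcd_dvd Gcd_greatest) auto
  finally show ?thesis
    by (simp add: dvd)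
qed

lemma (in field) inv_closed:
  "x \<in> carrier R \<Longrightarrow> x \<noteq> \<zero> \<Longrightarrow> inv x \<in> carrier R"
  by (simp add: field_Units)

lemma (in field) inv_nonzero:
  "x \<in> carrier R \<Longrightarrow> x \<noteq> \<zero> \<Longrightarrow> inv x \<noteq> \<zero>"
  using field_Units Units_inv_Units[of x] by auto

lemma (in field) r_inv_nonzero:
  "x \<in> carrier R \<Longrightarrow> x \<noteq> \<zero> \<Longrightarrow> x \<otimes> inv x = \<one>"
  by (simp add: field_Units)

lemma (in monoid) square_eq_mult:
  "x \<in> carrier G \<Longrightarrow> x [^] (2::nat) = x \<otimes> x"
  by (simp add: numeral_2_eq_2)

lemma (in field) vectorspace_mult_module:
  assumes K: "subfield K R" and F: "subfield F R" and "K \<subseteq> F"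
  shows "vectorspace (R\<lparr>carrier := K\<rparr>) (mult_module R F)"
proof -
  interpret K: field "R\<lparr>carrier := K\<rparr>"
    using subfield_iff(2)[OF K] .
  interpret F: field "R\<lparr>carrier := F\<rparr>"
    using subfield_iff(2)[OF F] .
  have FR: "F \<subseteq> carrier R"
    using subfieldE(3)[OF F] .
  have F_carrier: "x \<in> carrier R" if "x \<in> F" for x
    using FR that by blast
  have K_carrier: "x \<in> carrier R" if "x \<in> K" for x
    using FR \<open>K \<subseteq> F\<close> that by blast
  have mult: "x \<otimes> y \<in> F" if "x \<in> K" "y \<in> F" for x y
    using subringE(6)[OF subfieldE(1)[OF F]] \<open>K \<subseteq> F\<close> that by blast
  have "abelian_group (mult_module R F)"
  proof (rule abelian_groupI)
    show "\<exists>y\<in>carrier (mult_module R F). y \<oplus>\<^bsub>mult_module R F\<^esub> x = \<zero>\<^bsub>mult_module R F\<^esub>"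
      if "x \<in> carrier (mult_module R F)" for x
      using F.add.l_inv_ex that by (auto simp: mult_module_def)
  qed (use F.a_assoc F.a_comm F.add.m_closed F.zero_closed F.l_zero
        in \<open>auto simp: mult_module_def\<close>)
  then have "module (R\<lparr>carrier := K\<rparr>) (mult_module R F)"
    by (intro module.intro module_axioms.intro K.is_cring)
      (auto simp: mult_module_def mult F_carrier K_carrier l_distr r_distr m_assoc)
  then show ?thesis
    by (intro vectorspace.intro K.field_axioms)
qed

section \<open>Squares in characteristic two\<close>

locale char_two_field = field +
  assumes one_add_one: "\<one> \<oplus> \<one> = \<zero>"
begin

lemma add_self: "x \<in> carrier R \<Longrightarrow> x \<oplus> x = \<zero>"
  using l_distr[of \<one> \<one> x] one_add_one by simp

lemma minus_eq_self: "x \<in> carrier R \<Longrightarrow> \<ominus> x = x"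
  using add_self minus_equality by blast

lemma square_add:
  assumes "x \<in> carrier R" "y \<in> carrier R"
  shows "(x \<oplus> y) [^] (2::nat) = x [^] (2::nat) \<oplus> y [^] (2::nat)"
proof -
  have "(x \<oplus> y) [^] (2::nat) = x \<otimes> x \<oplus> (x \<otimes> y \<oplus> x \<otimes> y) \<oplus> y \<otimes> y"
    using assms by (simp add: square_eq_mult l_distr r_distr m_comm[of y x] a_ac)
  then show ?thesis
    using assms by (simp add: add_self square_eq_mult)
qed

lemma square_mult:
  "x \<in> carrier R \<Longrightarrow> y \<in> carrier R \<Longrightarrow>
    (x \<otimes> y) [^] (2::nat) = x [^] (2::nat) \<otimes> y [^] (2::nat)"
  by (rule nat_pow_distrib)

lemma square_inv:
  assumes "x \<in> carrier R" "x \<noteq> \<zero>"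
  shows "inv (x [^] (2::nat)) = (inv x) [^] (2::nat)"
  using assms
  by (intro comm_inv_char)
    (simp_all add: inv_closed r_inv_nonzero nat_pow_distrib[symmetric])

text \<open>Squaring is a field endomorphism in characteristic two, so it maps subfields to subfields.\<close>

lemma subfield_squares:
  assumes F: "subfield F R"
  shows "subfield (squares R F) R"
proof (rule subfieldI')
  have FR: "x \<in> carrier R" if "x \<in> F" for x
    using subfieldE(3)[OF F] that by blast
  have FE: "subring F R"
    using subfieldE(1)[OF F] .
  show "subring (squares R F) R"
  proof (rule subringI)
    show "squares R F \<subseteq> carrier R"
      using FR by (auto simp: squares_def)
    show "\<one> \<in> squares R F"
      using subringE(3)[OF FE] nat_pow_one[of 2, symmetric] unfolding squares_def by blast
    show "\<ominus> h \<in> squares R F" if "h \<in> squares R F" for h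
      using that FR by (auto simp: squares_def minus_eq_self)
    show "h1 \<otimes> h2 \<in> squares R F" if "h1 \<in> squares R F" "h2 \<in> squares R F" for h1 h2
      using that FR subringE(6)[OF FE] by (force simp: squares_def square_mult[symmetric])
    show "h1 \<oplus> h2 \<in> squares R F" if "h1 \<in> squares R F" "h2 \<in> squares R F" for h1 h2
      using that FR subringE(7)[OF FE] by (force simp: squares_def square_add[symmetric])
  qed
  fix k assume "k \<in> squares R F - {\<zero>}"
  then obtain x where x: "x \<in> F" "k = x [^] (2::nat)" "k \<noteq> \<zero>"
    by (auto simp: squares_def)
  then have "x \<noteq> \<zero>"
    by (auto simp: nat_pow_zero)
  with x have "inv x \<in> F"
    using subfield_m_inv(1)[OF F] by blast
  then show "inv k \<in> squares R F"
    using x \<open>x \<noteq> \<zero>\<close> FR by (auto simp: squares_def square_inv)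
qed

section \<open>The stabilizer of an inverse-closed additive subgroup\<close>

definition square_stabilizer :: "'a set \<Rightarrow> 'a set" where
  "square_stabilizer A = {x \<in> carrier R. \<forall>a\<in>A. x [^] (2::nat) \<otimes> a \<in> A}"

lemma square_stabilizerD:
  assumes "x \<in> square_stabilizer A"
  shows "x \<in> carrier R" and "a \<in> A \<Longrightarrow> x [^] (2::nat) \<otimes> a \<in> A"
  using assms by (auto simp: square_stabilizer_def)

context
  fixes A
  assumes A_subgroup: "additive_subgroup A R"
    and A_inverse_closed: "inverse_closed R A"
begin

interpretation A: additive_subgroup A R
  by (rule A_subgroup)

lemma inv_mem: "a \<in> A \<Longrightarrow> a \<noteq> \<zero> \<Longrightarrow> inv a \<in> A"
  using A_inverse_closed by (auto simp: inverse_closed_def set_inverses_def)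

text \<open>Hua's identity. It requires \<open>a\<close>, \<open>b\<close> and \<open>c = b\<^sup>-\<^sup>1 + a\<close> to be nonzero. Then
  \<open>a\<^sup>-\<^sup>1 + c\<^sup>-\<^sup>1 = (a + c) (a c)\<^sup>-\<^sup>1 = b\<^sup>-\<^sup>1 (a c)\<^sup>-\<^sup>1\<close>, whose inverse is \<open>a b c = a + a\<^sup>2 b\<close>.
  Here \<open>a + c = b\<^sup>-\<^sup>1\<close> because \<open>a + a = 0\<close>.
  In the exceptional case \<open>c = 0\<close> we have \<open>b = a\<^sup>-\<^sup>1\<close> and \<open>a\<^sup>2 b = a\<close>.\<close>

lemma inverse_closed_square_mult:
  assumes "a \<in> A" "b \<in> A"
  shows "a [^] (2::nat) \<otimes> b \<in> A"
proof -
  have carr: "a \<in> carrier R" "b \<in> carrier R"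
    using assms A.a_subset by auto
  define c where "c = inv b \<oplus> a"
  consider "a = \<zero>" | "b = \<zero>" | "a \<noteq> \<zero>" "b \<noteq> \<zero>" "c = \<zero>" | "a \<noteq> \<zero>" "b \<noteq> \<zero>" "c \<noteq> \<zero>"
    by blast
  then show ?thesis
  proof cases
    case 1
    then show ?thesis
      using carr assms by (simp add: nat_pow_zero)
  next
    case 2
    then show ?thesis
      using carr assms by simp
  next
    case 3
    have "inv b = a"
      using 3 carr minus_eq_self[of a] minus_equality[of "inv b" a]
      by (simp add: c_def inv_closed)
    then have "a \<otimes> b = \<one>"
      using 3 carr r_inv_nonzero[of b] m_comm[of b a] by simp
    then have "a [^] (2::nat) \<otimes> b = a"
      using carr by (simp add: square_eq_mult m_assoc)
    then show ?thesis
      using assms by simp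
  next
    case 4
    define d where "d = inv a \<oplus> inv c"
    \<comment> \<open>This is the inverse of \<open>d\<close>.\<close>
    define e where "e = a \<otimes> b \<otimes> c"
    have inv_carr: "inv a \<in> carrier R" "inv b \<in> carrier R"
      using 4 carr by (simp_all add: inv_closed)
    then have c_carr: "c \<in> carrier R"
      using carr by (simp add: c_def)
    then have inv_c: "inv c \<in> carrier R"
      using 4 by (simp add: inv_closed)
    have "c \<in> A"
      using 4 assms inv_mem by (simp add: c_def)
    then have "d \<in> A"
      using 4 assms inv_mem by (simp add: d_def)
    have d_carr: "d \<in> carrier R" and e_carr: "e \<in> carrier R"
      using carr c_carr inv_carr inv_c by (simp_all add: d_def e_def)
    have e_eq: "e = a \<oplus> a [^] (2::nat) \<otimes> b"
    proof -
      have "e = a \<otimes> (b \<otimes> inv b) \<oplus> a \<otimes> a \<otimes> b"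
        using carr inv_carr by (simp add: e_def c_def r_distr m_ac)
      then show ?thesis
        using carr 4 by (simp add: r_inv_nonzero square_eq_mult)
    qed
    have "d \<otimes> e = \<one>"
    proof -
      have "d \<otimes> e = (a \<otimes> inv a) \<otimes> (b \<otimes> c) \<oplus> (c \<otimes> inv c) \<otimes> (a \<otimes> b)"
        using carr c_carr inv_carr inv_c by (simp add: d_def e_def r_distr l_distr m_ac)
      also have "\<dots> = b \<otimes> c \<oplus> a \<otimes> b"
        using carr c_carr 4 by (simp add: r_inv_nonzero)
      also have "\<dots> = b \<otimes> inv b \<oplus> (a \<otimes> b \<oplus> a \<otimes> b)"
        using carr inv_carr by (simp add: c_def r_distr m_comm[of b a] a_assoc)
      also have "\<dots> = \<one>"
        using carr 4 by (simp add: r_inv_nonzero add_self)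
      finally show ?thesis .
    qed
    then have "inv d = e" and "d \<noteq> \<zero>"
      using comm_inv_char[OF d_carr e_carr] e_carr by auto
    then have "a \<oplus> e \<in> A"
      using inv_mem[OF \<open>d \<in> A\<close>] assms by auto
    moreover have "a \<oplus> e = (a \<oplus> a) \<oplus> a [^] (2::nat) \<otimes> b"
      using carr by (simp add: e_eq a_assoc)
    ultimately show ?thesis
      using carr by (simp add: add_self)
  qed
qed

text \<open>Apply \<open>x\<^sup>2\<close> to the inverse of \<open>a\<close> and invert the result: this gives \<open>x\<^sup>-\<^sup>2 a\<close>.\<close>

lemma square_stabilizer_inv:
  assumes x: "x \<in> square_stabilizer A" and "x \<noteq> \<zero>"
  shows "inv x \<in> square_stabilizer A"
proof -
  let ?y = "x [^] (2::nat)"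
  have x_carr: "x \<in> carrier R"
    using x by (rule square_stabilizerD)
  then have y: "?y \<in> carrier R" "?y \<noteq> \<zero>"
    using \<open>x \<noteq> \<zero>\<close> integral[of x x] by (auto simp: square_eq_mult)
  have "inv ?y \<otimes> a \<in> A" if a: "a \<in> A" for a
  proof (cases "a = \<zero>")
    case True
    then show ?thesis
      using y a by (simp add: inv_closed)
  next
    case False
    have a_carr: "a \<in> carrier R"
      using a A.a_subset by blast
    have carr: "inv a \<in> carrier R" "inv ?y \<in> carrier R"
      using False a_carr y by (simp_all add: inv_closed)
    have "?y \<otimes> inv a \<in> A"
      using square_stabilizerD(2)[OF x] inv_mem[OF a False] .
    moreover have "?y \<otimes> inv a \<noteq> \<zero>"
      using integral[of ?y "inv a"] y carr inv_nonzero[OF a_carr False] by auto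
    ultimately have "inv (?y \<otimes> inv a) \<in> A"
      by (rule inv_mem)
    moreover have "inv (?y \<otimes> inv a) = inv ?y \<otimes> a"
    proof (rule comm_inv_char)
      have "?y \<otimes> inv a \<otimes> (inv ?y \<otimes> a) = (?y \<otimes> inv ?y) \<otimes> (a \<otimes> inv a)"
        using y a_carr carr by (simp add: m_ac)
      then show "?y \<otimes> inv a \<otimes> (inv ?y \<otimes> a) = \<one>"
        using y a_carr False by (simp add: r_inv_nonzero)
    qed (use y a_carr carr in auto)
    ultimately show ?thesis
      by simp
  qed
  then show ?thesis
    using x_carr \<open>x \<noteq> \<zero>\<close> by (simp add: square_stabilizer_def inv_closed square_inv)
qed

lemma subfield_square_stabilizer: "subfield (square_stabilizer A) R"
proof (rule subfieldI')
  have A_carr: "a \<in> carrier R" if "a \<in> A" for a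
    using A.a_subset that by blast
  show "subring (square_stabilizer A) R"
  proof (rule subringI)
    show "square_stabilizer A \<subseteq> carrier R"
      by (auto simp: square_stabilizer_def)
    show "\<one> \<in> square_stabilizer A"
      using A_carr by (auto simp: square_stabilizer_def)
    show "\<ominus> h \<in> square_stabilizer A" if "h \<in> square_stabilizer A" for h
      using that square_stabilizerD(1)[OF that] by (simp add: minus_eq_self)
    show "h1 \<otimes> h2 \<in> square_stabilizer A"
      if "h1 \<in> square_stabilizer A" "h2 \<in> square_stabilizer A" for h1 h2
      using that A_carr by (auto simp: square_stabilizer_def square_mult m_assoc)
    show "h1 \<oplus> h2 \<in> square_stabilizer A"
      if "h1 \<in> square_stabilizer A" "h2 \<in> square_stabilizer A" for h1 h2
      using that A_carr by (auto simp: square_stabilizer_def square_add l_distr)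
  qed
  show "inv k \<in> square_stabilizer A" if "k \<in> square_stabilizer A - {\<zero>}" for k
    using that square_stabilizer_inv by blast
qed

lemma subset_square_stabilizer: "A \<subseteq> square_stabilizer A"
  using inverse_closed_square_mult A.a_subset by (auto simp: square_stabilizer_def)

lemma subspace_square_stabilizer:
  "VectorSpace.subspace (R\<lparr>carrier := squares R (square_stabilizer A)\<rparr>) A
    (mult_module R (square_stabilizer A))"
proof -
  let ?F = "square_stabilizer A"
  have F: "subfield ?F R"
    by (rule subfield_square_stabilizer)
  have "squares R ?F \<subseteq> ?F"
    using subringE(6)[OF subfieldE(1)[OF F]] square_stabilizerD(1)[of _ A]
    by (auto simp: squares_def square_eq_mult)
  then have "vectorspace (R\<lparr>carrier := squares R ?F\<rparr>) (mult_module R ?F)"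
    using vectorspace_mult_module[OF subfield_squares[OF F] F] by blast
  moreover from this have "LinearCombinations.submodule
      (R\<lparr>carrier := squares R ?F\<rparr>) A (mult_module R ?F)"
    unfolding vectorspace_def
    by (intro submodule.intro)
      (use subset_square_stabilizer square_stabilizerD(2)[of _ A]
        in \<open>auto simp: mult_module_def squares_def\<close>)
  ultimately show ?thesis
    by (rule VectorSpace.subspace.intro)
qed

end

end

section \<open>Inverse-closed additive subgroups are subspaces\<close>

theorem theorem2:
  fixes E :: "('a, 'b) ring_scheme" and A :: "'a set"
  assumes "Ring.field E"
    and "ring_characteristic E = 2"
    and "additive_subgroup A E"
    and "inverse_closed E A"
  shows "\<exists>F. subfield F E \<and> A \<subseteq> F \<and>
    VectorSpace.subspace (E\<lparr>carrier := squares E F\<rparr>) A (mult_module E F)"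
proof -
  interpret field E
    by (rule assms(1))
  have "\<one>\<^bsub>E\<^esub> \<oplus>\<^bsub>E\<^esub> \<one>\<^bsub>E\<^esub> = \<zero>\<^bsub>E\<^esub>"
    using add_pow_ring_characteristic assms(2) by (simp add: numeral_2_eq_2)
  then interpret char_two_field E
    by unfold_locales
  show ?thesis
    using subfield_square_stabilizer subset_square_stabilizer subspace_square_stabilizer assms(3,4)
    by blast
qed

end
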